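(* Let $q(t)=(x(t),z(t))$ be an arc-length parameterized sub-Riemannian geodesic of the $(3,6)$ control problem on $M=\mathbb{R}^3\oplus\mathbb{R}^3$ with $x(0)=0$, $z(0)=0$. View $q$ as the curve $x(t)+z(t)$ in $\wedge^1\mathbb{R}^3\oplus\wedge^2\mathbb{R}^3\subset\mathbb{G}_3$. Then there exist $R\in SO(3)$ and real constants $K>0$, $D$, $C_3$ with $D^2+C_3^2=1$ such that, up to the action of $R$, namely $(x,z)\mapsto(Rx,Rz)$, the curve takes the form $$\begin{aligned} q(t)=x(t)+z(t)=&\ \tfrac{D}{K}(1-\cos(Kt))\,e_1+\tfrac{D}{K}\sin(Kt)\,e_2+C_3t\,e_3\\ &-\tfrac{D^2}{2K^2}\big(Kt-\sin(Kt)\big)\,e_1\wedge e_2\\ &-\tfrac{C_3D}{2K^2}\big(Kt-2\sin(Kt)+Kt\cos(Kt)\big)\,e_3\wedge e_1\\ &+\tfrac{C_3D}{2K^2}\big(2-Kt\sin(Kt)-2\cos(Kt)\big)\,e_2\wedge e_3 . \end{aligned}$$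
   Context: The $(3,6)$ control problem: on $M=\mathbb{R}^6$ with coordinates $(x,z)=(x_1,x_2,x_3,z_1,z_2,z_3)$, the vector fields $X_1=\partial_{x_1}+\frac{x_3}{2}\partial_{z_2}-\frac{x_2}{2}\partial_{z_3}$, $X_2=\partial_{x_2}+\frac{x_1}{2}\partial_{z_3}-\frac{x_3}{2}\partial_{z_1}$, $X_3=\partial_{x_3}+\frac{x_2}{2}\partial_{z_1}-\frac{x_1}{2}\partial_{z_2}$ are declared orthonormal, and one minimizes $\frac12\int(u_1^2+u_2^2+u_3^2)\,dt$ subject to $\dot q=u_1X_1+u_2X_2+u_3X_3$. Geodesics are the projections to $M$ of the normal Pontryagin extremals of $H=\frac12(h_1^2+h_2^2+h_3^2)$. Explicitly, a geodesic is a curve $(x(t),z(t))$ for which there are real constants $K_1,K_2,K_3$ and a function $h(t)\in\mathbb{R}^3$ with $$\dot h=-\Omega h,\quad \Omega=\begin{pmatrix}0&K_1&K_2\\-K_1&0&K_3\\-K_2&-K_3&0\end{pmatrix},\qquad \dot x=h,\qquad \dot z=\tfrac12\,x\times h,$$ where $\times$ is the vector product on $\mathbb{R}^3$. It is arc-length parameterized if $\|h(t)\|=1$ (equivalently $H=1/2$). $\mathbb{G}_3$ is the geometric (Clifford) algebra of Euclidean $\mathbb{R}^3$ with standard orthonormal basis $e_1,e_2,e_3$, and $\wedge^k\mathbb{R}^3$ is its grade-$k$ part. The point $(x,z)\in M$ is identified with $x_1e_1+x_2e_2+x_3e_3+z_1\,e_2\wedge e_3+z_2\,e_3\wedge e_1+z_3\,e_1\wedge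 e_2$. Under this identification the action $(x,z)\mapsto(Rx,Rz)$ of $SO(3)$ is the natural action on vectors and bivectors. *)

theory Defs
  imports "HOL-Analysis.Analysis"
begin

unbundle cross3_syntax

section \<open>The geometric algebra of Euclidean three-space\<close>

text \<open>
  A multivector is given by its coordinates in the basis of blades \<open>e\<^sub>A\<close>, where \<open>A\<close> ranges over the
  sets of indices and \<open>e\<^sub>A\<close> is the product of the \<open>e\<^sub>i\<close> with \<open>i \<in> A\<close>, taken in increasing order.
  Since \<open>e\<^sub>i e\<^sub>j = - e\<^sub>j e\<^sub>i\<close> for \<open>i \<noteq> j\<close> and \<open>e\<^sub>i e\<^sub>i = 1\<close>, the product \<open>e\<^sub>A e\<^sub>B\<close> is \<open>e\<^bsub>A\<triangle>B\<^esub>\<close> up to one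
  sign for every pair \<open>b < a\<close> with \<open>a \<in> A\<close> and \<open>b \<in> B\<close>.  In the index type we have \<open>3 = 0\<close>, so the
  order is \<open>3 < 1 < 2\<close>; the choice of order only affects the signs of the basis blades.
\<close>

type_synonym multivector = "real ^ (3 set)"

definition blade :: "3 set \<Rightarrow> multivector" where
  "blade A = axis A 1"

definition blade_sign :: "3 set \<Rightarrow> 3 set \<Rightarrow> real" where
  "blade_sign A B = (\<Prod>a\<in>A. \<Prod>b\<in>B. if b < a then - 1 else 1)"

definition gprod :: "multivector \<Rightarrow> multivector \<Rightarrow> multivector"  (infixl \<open>\<cdot>\<^sub>G\<close> 76) where
  "u \<cdot>\<^sub>G v = (\<Sum>A\<in>UNIV. \<Sum>B\<in>UNIV. (u $ A * v $ B * blade_sign A B) *\<^sub>R blade (sym_diff A B))"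

definition grade :: "nat \<Rightarrow> multivector \<Rightarrow> multivector" where
  "grade k u = (\<chi> A. if card A = k then u $ A else 0)"

definition wedge :: "multivector \<Rightarrow> multivector \<Rightarrow> multivector"  (infixl \<open>\<and>\<^sub>G\<close> 76) where
  "u \<and>\<^sub>G v = (\<Sum>r\<le>3. \<Sum>s\<le>3. grade (r + s) (grade r u \<cdot>\<^sub>G grade s v))"

definition e\<^sub>G :: "3 \<Rightarrow> multivector" where
  "e\<^sub>G i = blade {i}"

definition gvec :: "real ^ 3 \<Rightarrow> multivector" where
  "gvec x = x $ 1 *\<^sub>R e\<^sub>G 1 + x $ 2 *\<^sub>R e\<^sub>G 2 + x $ 3 *\<^sub>R e\<^sub>G 3"

definition gbivec :: "real ^ 3 \<Rightarrow> multivector" where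
  "gbivec z = z $ 1 *\<^sub>R (e\<^sub>G 2 \<and>\<^sub>G e\<^sub>G 3) + z $ 2 *\<^sub>R (e\<^sub>G 3 \<and>\<^sub>G e\<^sub>G 1) + z $ 3 *\<^sub>R (e\<^sub>G 1 \<and>\<^sub>G e\<^sub>G 2)"

definition to_mv :: "(real ^ 3) \<times> (real ^ 3) \<Rightarrow> multivector" where
  "to_mv q = gvec (fst q) + gbivec (snd q)"

lemma blade_nth: "blade A $ B = (if A = B then 1 else 0)"
  by (auto simp: blade_def axis_def)

lemma gprod_nth: "(u \<cdot>\<^sub>G v) $ C = (\<Sum>A\<in>UNIV. u $ A * v $ (sym_diff A C) * blade_sign A (sym_diff A C))"
proof -
  have "(\<Sum>B\<in>UNIV. (u $ A * v $ B * blade_sign A B) * blade (sym_diff A B) $ C)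
      = u $ A * v $ (sym_diff A C) * blade_sign A (sym_diff A C)" for A
  proof -
    have "(sym_diff A B = C) = (B = sym_diff A C)" for B
      by blast
    then have "(\<Sum>B\<in>UNIV. (u $ A * v $ B * blade_sign A B) * blade (sym_diff A B) $ C)
      = (\<Sum>B\<in>UNIV. if B = sym_diff A C then u $ A * v $ B * blade_sign A B else 0)"
      by (intro sum.cong) (auto simp: blade_nth)
    then show ?thesis
      by simp
  qed
  then show ?thesis
    by (simp add: gprod_def)
qed

lemma sign_square: "(if P then - 1 else 1 :: real) * (if P then - 1 else 1) = 1"
  by simp

lemma blade_sign_sym_diff_left:
  "blade_sign (sym_diff A B) C = blade_sign A C * blade_sign B C"
proof -
  define f :: "3 \<Rightarrow> real" where "f = (\<lambda>a. \<Prod>b\<in>C. if b < a then - 1 else 1)"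
  have sq: "f a * f a = 1" for a
    unfolding f_def by (simp add: sign_square flip: prod.distrib)
  have "prod f A = prod f (A - B) * prod f (A \<inter> B)"
    by (subst prod.union_disjoint[symmetric]) (auto intro!: prod.cong)
  moreover have "prod f B = prod f (B - A) * prod f (A \<inter> B)"
    by (subst prod.union_disjoint[symmetric]) (auto intro!: prod.cong)
  moreover have "prod f (A \<inter> B) * prod f (A \<inter> B) = 1"
    by (simp add: sq flip: prod.distrib)
  moreover have "prod f (sym_diff A B) = prod f (A - B) * prod f (B - A)"
    by (subst prod.union_disjoint) auto
  ultimately have "prod f (sym_diff A B) = prod f A * prod f B"
    by (metis (no_types, lifting) mult.assoc mult.commute mult.right_neutral)
  then show ?thesis
    by (simp add: blade_sign_def f_def)
qed

lemma blade_sign_sym_diff_right: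
  "blade_sign C (sym_diff A B) = blade_sign C A * blade_sign C B"
proof -
  have "(\<Prod>b\<in>sym_diff A B. if b < a then - 1 else 1 :: real)
     = (\<Prod>b\<in>A. if b < a then - 1 else 1) * (\<Prod>b\<in>B. if b < a then - 1 else 1)" for a :: 3
  proof -
    define f :: "3 \<Rightarrow> real" where "f = (\<lambda>b. if b < a then - 1 else 1)"
    have "prod f A = prod f (A - B) * prod f (A \<inter> B)"
      by (subst prod.union_disjoint[symmetric]) (auto intro!: prod.cong)
    moreover have "prod f B = prod f (B - A) * prod f (A \<inter> B)"
      by (subst prod.union_disjoint[symmetric]) (auto intro!: prod.cong)
    moreover have "prod f (A \<inter> B) * prod f (A \<inter> B) = 1"
      by (simp add: f_def sign_square flip: prod.distrib)
    moreover have "prod f (sym_diff A B) = prod f (A - B) * prod f (B - A)"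
      by (subst prod.union_disjoint) auto
    ultimately have "prod f (sym_diff A B) = prod f A * prod f B"
      by (metis (no_types, lifting) mult.assoc mult.commute mult.right_neutral)
    then show ?thesis
      by (simp add: f_def)
  qed
  then show ?thesis
    by (simp add: blade_sign_def prod.distrib)
qed

lemma gprod_assoc: "(u \<cdot>\<^sub>G v) \<cdot>\<^sub>G w = u \<cdot>\<^sub>G (v \<cdot>\<^sub>G w)"
proof -
  have "((u \<cdot>\<^sub>G v) \<cdot>\<^sub>G w) $ D = (u \<cdot>\<^sub>G (v \<cdot>\<^sub>G w)) $ D" for D
  proof -
    have "((u \<cdot>\<^sub>G v) \<cdot>\<^sub>G w) $ D
      = (\<Sum>C\<in>UNIV. \<Sum>A\<in>UNIV. u $ A * v $ (sym_diff A C) * blade_sign A (sym_diff A C)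
          * w $ (sym_diff C D) * blade_sign C (sym_diff C D))"
      by (simp add: gprod_nth sum_distrib_right)
    also have "\<dots> = (\<Sum>A\<in>UNIV. \<Sum>C\<in>UNIV. u $ A * v $ (sym_diff A C) * blade_sign A (sym_diff A C)
          * w $ (sym_diff C D) * blade_sign C (sym_diff C D))"
      by (rule sum.swap)
    also have "\<dots> = (\<Sum>A\<in>UNIV. \<Sum>B\<in>UNIV. u $ A * v $ B * blade_sign A B
          * w $ (sym_diff (sym_diff A B) D)
          * blade_sign (sym_diff A B) (sym_diff (sym_diff A B) D))"
    proof (rule sum.cong[OF refl])
      fix A :: "3 set"
      have inv: "sym_diff A (sym_diff A B) = B" for B
        by blast
      show "(\<Sum>C\<in>UNIV. u $ A * v $ (sym_diff A C) * blade_sign A (sym_diff A C)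
          * w $ (sym_diff C D) * blade_sign C (sym_diff C D))
        = (\<Sum>B\<in>UNIV. u $ A * v $ B * blade_sign A B * w $ (sym_diff (sym_diff A B) D)
          * blade_sign (sym_diff A B) (sym_diff (sym_diff A B) D))"
        by (rule sum.reindex_bij_witness[where i = "sym_diff A" and j = "sym_diff A"])
          (simp_all only: inv UNIV_I)
    qed
    also have "\<dots> = (\<Sum>A\<in>UNIV. \<Sum>B\<in>UNIV. u $ A * (v $ B * w $ (sym_diff B (sym_diff A D))
          * blade_sign B (sym_diff B (sym_diff A D))) * blade_sign A (sym_diff A D))"
    proof (intro sum.cong refl)
      fix A B :: "3 set"
      have 1: "sym_diff (sym_diff A B) D = sym_diff B (sym_diff A D)"
        by blast
      have "blade_sign A B * blade_sign (sym_diff A B) (sym_diff B (sym_diff A D))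
        = (blade_sign A B * blade_sign A B) * (blade_sign A (sym_diff A D)
          * blade_sign B (sym_diff B (sym_diff A D)))"
        by (simp only: blade_sign_sym_diff_left blade_sign_sym_diff_right) (simp only: mult_ac)
      also have "blade_sign A B * blade_sign A B = 1"
        by (simp add: blade_sign_def sign_square flip: prod.distrib)
      finally have 2: "blade_sign A B * blade_sign (sym_diff A B) (sym_diff B (sym_diff A D))
        = blade_sign A (sym_diff A D) * blade_sign B (sym_diff B (sym_diff A D))"
        by simp
      have "u $ A * v $ B * blade_sign A B * w $ (sym_diff (sym_diff A B) D)
          * blade_sign (sym_diff A B) (sym_diff (sym_diff A B) D)
        = u $ A * v $ B * w $ (sym_diff B (sym_diff A D))
          * (blade_sign A B * blade_sign (sym_diff A B) (sym_diff B (sym_diff A D)))"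
        unfolding 1 by (simp only: mult_ac)
      also have "\<dots> = u $ A * (v $ B * w $ (sym_diff B (sym_diff A D))
          * blade_sign B (sym_diff B (sym_diff A D))) * blade_sign A (sym_diff A D)"
        unfolding 2 by (simp only: mult_ac)
      finally show "u $ A * v $ B * blade_sign A B * w $ (sym_diff (sym_diff A B) D)
          * blade_sign (sym_diff A B) (sym_diff (sym_diff A B) D)
        = u $ A * (v $ B * w $ (sym_diff B (sym_diff A D))
          * blade_sign B (sym_diff B (sym_diff A D))) * blade_sign A (sym_diff A D)" .
    qed
    also have "\<dots> = (u \<cdot>\<^sub>G (v \<cdot>\<^sub>G w)) $ D"
      by (simp add: gprod_nth sum_distrib_left sum_distrib_right)
    finally show ?thesis .
  qed
  then show ?thesis
    by (simp add: vec_eq_iff)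
qed

lemma gprod_blade: "blade A \<cdot>\<^sub>G blade B = blade_sign A B *\<^sub>R blade (sym_diff A B)"
proof -
  have "blade A \<cdot>\<^sub>G blade B
    = (\<Sum>A'\<in>UNIV. \<Sum>B'\<in>UNIV. if B' = B then if A' = A then
         blade_sign A' B' *\<^sub>R blade (sym_diff A' B') else 0 else 0)"
    unfolding gprod_def by (intro sum.cong refl) (auto simp: blade_nth)
  then show ?thesis
    by simp
qed

lemma gprod_add_left: "(u + v) \<cdot>\<^sub>G w = u \<cdot>\<^sub>G w + v \<cdot>\<^sub>G w"
  by (simp add: gprod_def algebra_simps sum.distrib)

lemma gprod_add_right: "u \<cdot>\<^sub>G (v + w) = u \<cdot>\<^sub>G v + u \<cdot>\<^sub>G w"
  by (simp add: gprod_def algebra_simps sum.distrib)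

lemma gprod_scaleR_left: "(c *\<^sub>R u) \<cdot>\<^sub>G v = c *\<^sub>R (u \<cdot>\<^sub>G v)"
  by (simp add: gprod_def scaleR_sum_right mult.assoc)

lemma gprod_scaleR_right: "u \<cdot>\<^sub>G (c *\<^sub>R v) = c *\<^sub>R (u \<cdot>\<^sub>G v)"
  by (simp add: gprod_def scaleR_sum_right mult_ac)

lemma gprod_zero_left: "0 \<cdot>\<^sub>G v = 0"
  by (simp add: gprod_def)

lemma gprod_zero_right: "u \<cdot>\<^sub>G 0 = 0"
  by (simp add: gprod_def)

lemma gprod_one_left: "blade {} \<cdot>\<^sub>G u = u"
  by (simp add: vec_eq_iff gprod_nth blade_nth blade_sign_def if_distrib if_distribR cong: if_cong)

lemma gprod_one_right: "u \<cdot>\<^sub>G blade {} = u"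
proof -
  have "(u \<cdot>\<^sub>G blade {}) $ C = u $ C" for C
  proof -
    have eq: "({} = sym_diff A C) = (A = C)" for A
      by blast
    have "(u \<cdot>\<^sub>G blade {}) $ C = (\<Sum>A\<in>UNIV. if A = C then u $ A * blade_sign A (sym_diff A C) else 0)"
      unfolding gprod_nth blade_nth eq by (intro sum.cong) auto
    then show ?thesis
      by (simp add: blade_sign_def)
  qed
  then show ?thesis
    by (simp add: vec_eq_iff)
qed

lemma less_3: "(3::3) < 1" "(3::3) < 2" "(1::3) < 2" "\<not> (1::3) < 3" "\<not> (2::3) < 3" "\<not> (2::3) < 1"
  by (simp_all add: less_bit1_def bit1.Rep_numeral bit1.Rep_1)

lemma e_sq: "e\<^sub>G i \<cdot>\<^sub>G e\<^sub>G i = blade {}"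
  by (simp add: e\<^sub>G_def gprod_blade blade_sign_def)

lemma e_anticommute: "i \<noteq> j \<Longrightarrow> e\<^sub>G i \<cdot>\<^sub>G e\<^sub>G j = - (e\<^sub>G j \<cdot>\<^sub>G e\<^sub>G i)"
  by (auto simp: e\<^sub>G_def gprod_blade blade_sign_def Un_commute insert_Diff_if)

lemma clifford_relation: "gvec x \<cdot>\<^sub>G gvec y + gvec y \<cdot>\<^sub>G gvec x = (2 * (x \<bullet> y)) *\<^sub>R blade {}"
proof -
  have c: "e\<^sub>G 2 \<cdot>\<^sub>G e\<^sub>G 1 = - (e\<^sub>G 1 \<cdot>\<^sub>G e\<^sub>G 2)" "e\<^sub>G 3 \<cdot>\<^sub>G e\<^sub>G 1 = - (e\<^sub>G 1 \<cdot>\<^sub>G e\<^sub>G 3)" "e\<^sub>G 3 \<cdot>\<^sub>G e\<^sub>G 2 = - (e\<^sub>G 2 \<cdot>\<^sub>G e\<^sub>G 3)"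
    by (rule e_anticommute, simp)+
  show ?thesis
    by (simp add: gvec_def gprod_add_left gprod_add_right gprod_scaleR_left gprod_scaleR_right e_sq c
        inner_vec_def sum_3 vec_eq_iff algebra_simps)
qed

lemma grade_add: "grade k (u + v) = grade k u + grade k v"
  by (auto simp: grade_def vec_eq_iff)

lemma grade_scaleR: "grade k (c *\<^sub>R u) = c *\<^sub>R grade k u"
  by (auto simp: grade_def vec_eq_iff)

lemma grade_zero: "grade k 0 = 0"
  by (auto simp: grade_def vec_eq_iff)

lemma grade_blade: "grade k (blade A) = (if card A = k then blade A else 0)"
  by (auto simp: grade_def vec_eq_iff blade_nth)

lemma wedge_add_left: "(u + v) \<and>\<^sub>G w = u \<and>\<^sub>G w + v \<and>\<^sub>G w"
  by (simp add: wedge_def grade_add gprod_add_left sum.distrib)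

lemma wedge_add_right: "u \<and>\<^sub>G (v + w) = u \<and>\<^sub>G v + u \<and>\<^sub>G w"
  by (simp add: wedge_def grade_add gprod_add_right sum.distrib)

lemma wedge_scaleR_left: "(c *\<^sub>R u) \<and>\<^sub>G v = c *\<^sub>R (u \<and>\<^sub>G v)"
  by (simp add: wedge_def grade_scaleR gprod_scaleR_left scaleR_sum_right)

lemma wedge_scaleR_right: "u \<and>\<^sub>G (c *\<^sub>R v) = c *\<^sub>R (u \<and>\<^sub>G v)"
  by (simp add: wedge_def grade_scaleR gprod_scaleR_right scaleR_sum_right)

lemma wedge_e: "e\<^sub>G i \<and>\<^sub>G e\<^sub>G j = (if i = j then 0 else e\<^sub>G i \<cdot>\<^sub>G e\<^sub>G j)"
proof -
  have "e\<^sub>G i \<and>\<^sub>G e\<^sub>G j = (\<Sum>r\<le>3::nat. \<Sum>s\<le>3::nat. if s = 1 then if r = 1 then grade 2 (e\<^sub>G i \<cdot>\<^sub>G e\<^sub>G j) else 0 else 0)"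
    unfolding wedge_def
    by (intro sum.cong refl)
      (auto simp: e\<^sub>G_def grade_blade gprod_zero_left gprod_zero_right grade_zero numeral_2_eq_2)
  also have "\<dots> = grade 2 (e\<^sub>G i \<cdot>\<^sub>G e\<^sub>G j)"
    by simp
  also have "\<dots> = (if i = j then 0 else e\<^sub>G i \<cdot>\<^sub>G e\<^sub>G j)"
    by (auto simp: e\<^sub>G_def gprod_blade grade_scaleR grade_blade insert_Diff_if)
  finally show ?thesis .
qed

lemma grade_gvec: "grade 1 (gvec x) = gvec x"
  by (simp add: gvec_def grade_add grade_scaleR e\<^sub>G_def grade_blade)

lemma grade_gbivec: "grade 2 (gbivec z) = gbivec z"
  unfolding gbivec_def wedge_e
  by (simp add: e\<^sub>G_def gprod_blade grade_add grade_scaleR grade_blade insert_Diff_if)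

lemma wedge_gvec: "gvec x \<and>\<^sub>G gvec y = gbivec (x \<times> y)"
proof -
  have c: "e\<^sub>G 2 \<cdot>\<^sub>G e\<^sub>G 1 = - (e\<^sub>G 1 \<cdot>\<^sub>G e\<^sub>G 2)" "e\<^sub>G 1 \<cdot>\<^sub>G e\<^sub>G 3 = - (e\<^sub>G 3 \<cdot>\<^sub>G e\<^sub>G 1)" "e\<^sub>G 3 \<cdot>\<^sub>G e\<^sub>G 2 = - (e\<^sub>G 2 \<cdot>\<^sub>G e\<^sub>G 3)"
    by (rule e_anticommute, simp)+
  show ?thesis
    by (simp add: gvec_def gbivec_def wedge_add_left wedge_add_right wedge_scaleR_left
        wedge_scaleR_right wedge_e c cross3_def algebra_simps)
qed

text \<open>Multiplying both components by a rotation is the natural action on vectors and bivectors.\<close>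

lemma wedge_gvec_rotation:
  assumes "rotation_matrix R"
  shows "gvec (R *v x) \<and>\<^sub>G gvec (R *v y) = gbivec (R *v (x \<times> y))"
  using assms by (simp add: wedge_gvec cross_rotation_matrix)

lemma to_mv_inject: "to_mv p = to_mv q \<longleftrightarrow> p = q"
proof
  assume eq: "to_mv p = to_mv q"
  have nth: "to_mv q $ {1} = fst q $ 1" "to_mv q $ {2} = fst q $ 2" "to_mv q $ {3} = fst q $ 3"
    "to_mv q $ {2, 3} = - snd q $ 1" "to_mv q $ {3, 1} = snd q $ 2" "to_mv q $ {1, 2} = snd q $ 3" for q
    unfolding to_mv_def gvec_def gbivec_def wedge_e
    by (auto simp: e\<^sub>G_def gprod_blade blade_nth blade_sign_def
        less_3 insert_Diff_if doubleton_eq_iff)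
  have "fst p = fst q" "snd p = snd q"
    using nth[of p] nth[of q] eq by (simp_all add: vec_eq_iff forall_3)
  then show "p = q"
    by (rule prod_eqI)
qed simp

section \<open>Sub-Riemannian geodesics of the (3,6) problem\<close>

definition Omega :: "real \<Rightarrow> real \<Rightarrow> real \<Rightarrow> real ^ 3 ^ 3" where
  "Omega K1 K2 K3 = vector
    [vector [0, K1, K2],
     vector [- K1, 0, K3],
     vector [- K2, - K3, 0]]"

text \<open>
  The time domain \<open>T\<close> is an interval; derivatives at an endpoint of \<open>T\<close> are one-sided.
  The function \<open>h\<close> collects the coordinates \<open>h\<^sub>i\<close> of the covector along the normal extremal.
\<close>

definition normal_extremal ::
  "real set \<Rightarrow> real \<Rightarrow> real \<Rightarrow> real \<Rightarrow> (real \<Rightarrow> real ^ 3) \<Rightarrow> (real \<Rightarrow> (real ^ 3) \<times> (real ^ 3)) \<Rightarrow> bool"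
where
  "normal_extremal T K1 K2 K3 h q \<longleftrightarrow>
    (\<forall>t\<in>T.
      (h has_vector_derivative - (Omega K1 K2 K3 *v h t)) (at t within T) \<and>
      ((\<lambda>s. fst (q s)) has_vector_derivative h t) (at t within T) \<and>
      ((\<lambda>s. snd (q s)) has_vector_derivative (1 / 2) *\<^sub>R (fst (q t) \<times> h t)) (at t within T))"

definition arclength_geodesic :: "real set \<Rightarrow> (real \<Rightarrow> (real ^ 3) \<times> (real ^ 3)) \<Rightarrow> bool" where
  "arclength_geodesic T q \<longleftrightarrow>
    (\<exists>K1 K2 K3 h. normal_extremal T K1 K2 K3 h q \<and> (\<forall>t\<in>T. norm (h t) = 1))"

definition SO3_action :: "real ^ 3 ^ 3 \<Rightarrow> (real ^ 3) \<times> (real ^ 3) \<Rightarrow> (real ^ 3) \<times> (real ^ 3)" where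
  "SO3_action R q = (R *v fst q, R *v snd q)"

end

theory Submission
  imports Defs
begin

text \<open>
  The covector equation reads \<open>h' = w \<times> h\<close> for a constant vector \<open>w\<close>.  A rotation that puts \<open>w\<close> on
  the third axis, pointing downwards, and annihilates the first coordinate of \<open>h(0)\<close> commutes with
  the vector product, so it turns the whole system into the one solved by the explicit curve.
  Two solutions of \<open>h' = w \<times> h\<close> keep their distance because \<open>w \<times>\<close> is skew, so the
  covectors agree; then so do \<open>x\<close> and \<open>z\<close>, which have equal derivatives.  If \<open>w = 0\<close> the
  covector is constant: rotating it to the third axis gives \<open>D = 0\<close>, and \<open>K\<close> is arbitrary.
\<close>

section \<open>Derivatives along an interval and uniqueness of solutions\<close>

lemma has_vector_derivative_vector_3:
  fixes a b c :: "real \<Rightarrow> real"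
  assumes "(a has_real_derivative a') (at t within T)"
    and "(b has_real_derivative b') (at t within T)"
    and "(c has_real_derivative c') (at t within T)"
  shows "((\<lambda>s. vector [a s, b s, c s] :: real ^ 3) has_vector_derivative vector [a', b', c'])
    (at t within T)"
proof -
  have eq: "(vector [u, v, w] :: real ^ 3) = u *\<^sub>R axis 1 1 + v *\<^sub>R axis 2 1 + w *\<^sub>R axis 3 1"
    for u v w :: real
    by (simp add: vec_eq_iff forall_3 axis_def)
  show ?thesis
    unfolding eq using assms by (auto intro!: derivative_eq_intros)
qed

lemma has_vector_derivative_matrix_vector_mult:
  fixes A :: "real ^ 'n ^ 'm"
  assumes "(f has_vector_derivative f') F"
  shows "((\<lambda>s. A *v f s) has_vector_derivative A *v f') F"
  using bounded_linear.has_vector_derivative[OF matrix_vector_mul_bounded_linear assms] .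

text \<open>The difference has derivative zero, hence is constant on the convex set
  \<open>T\<close>. Derivatives within \<open>T\<close> suffice, so endpoints need no separate
  treatment.\<close>

lemma has_vector_derivative_unique_on_convex:
  assumes "convex T" and "t\<^sub>0 \<in> T" and "f t\<^sub>0 = g t\<^sub>0" and "t \<in> T"
    and "\<And>s. s \<in> T \<Longrightarrow> (f has_vector_derivative d s) (at s within T)"
    and "\<And>s. s \<in> T \<Longrightarrow> (g has_vector_derivative d s) (at s within T)"
  shows "f t = g t"
proof -
  have "((\<lambda>s. f s - g s) has_vector_derivative 0) (at s within T)" if "s \<in> T" for s
    using has_vector_derivative_diff[OF assms(5,6)] that by fastforce
  then obtain c where "\<And>s. s \<in> T \<Longrightarrow> f s - g s = c"
    using has_vector_derivative_zero_constant[OF assms(1)] by blast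
  with assms(2-4) show ?thesis
    by (metis eq_iff_diff_eq_0)
qed

text \<open>By linearity the difference \<open>d\<close> solves the same equation, and the
  derivative of \<open>d s \<bullet> d s\<close> is twice \<open>d s \<bullet> B (d s)\<close>,
  which vanishes by skewness. This conserved quantity replaces a Gronwall estimate.\<close>

lemma linear_skew_ode_unique:
  fixes f g :: "real \<Rightarrow> 'a::real_inner"
  assumes "convex T" and "t\<^sub>0 \<in> T" and "f t\<^sub>0 = g t\<^sub>0" and "t \<in> T"
    and "linear B" and skew: "\<And>x. x \<bullet> B x = 0"
    and f: "\<And>s. s \<in> T \<Longrightarrow> (f has_vector_derivative B (f s)) (at s within T)"
    and g: "\<And>s. s \<in> T \<Longrightarrow> (g has_vector_derivative B (g s)) (at s within T)"
  shows "f t = g t"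
proof -
  define d where "d s = f s - g s" for s
  have d: "(d has_vector_derivative B (d s)) (at s within T)" if "s \<in> T" for s
    using has_vector_derivative_diff[OF f g] that
    by (simp add: d_def[abs_def] linear_diff[OF \<open>linear B\<close>])
  have dd: "((\<lambda>s. d s \<bullet> d s) has_vector_derivative 0) (at s within T)" if "s \<in> T" for s
    using bounded_bilinear.has_vector_derivative[OF bounded_bilinear_inner d d] that
    by (simp add: skew inner_commute[of "B _"])
  have "d t\<^sub>0 \<bullet> d t\<^sub>0 = 0"
    by (simp add: d_def assms(3))
  from has_vector_derivative_unique_on_convex[OF assms(1,2) this assms(4) dd
      has_vector_derivative_const]
  have "d t \<bullet> d t = 0" .
  then show ?thesis
    by (simp add: d_def)
qed

section \<open>The axial vector of the covector equation and adapted rotations\<close>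

lemma Omega_mult_eq_cross: "- (Omega K1 K2 K3 *v h) = vector [K3, - K2, K1] \<times> h"
  by (simp add: Omega_def cross3_def matrix_vector_mult_def vec_eq_iff forall_3 sum_3 algebra_simps)

lemma rotation_matrix_from_orthonormal_pair:
  fixes a c :: "real ^ 3"
  assumes "norm a = 1" and "norm c = 1" and "a \<bullet> c = 0"
  shows "rotation_matrix (vector [a, c \<times> a, c])"
proof -
  have aa: "a \<bullet> a = 1" and cc: "c \<bullet> c = 1"
    using assms by (simp_all add: norm_eq_1)
  have bb: "(c \<times> a) \<bullet> (c \<times> a) = 1"
    using norm_cross_dot[of c a] assms
    by (simp add: inner_commute[of c] power2_norm_eq_inner)
  have rows: "(vector [a, c \<times> a, c] :: real ^ 3 ^ 3) $ i \<bullet> (vector [a, c \<times> a, c] :: real ^ 3 ^ 3) $ j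
      = (if i = j then 1 else 0)" for i j
    using exhaust_3[of i] exhaust_3[of j] aa bb cc assms(3)
    by (auto simp: dot_cross_self inner_commute)
  have "orthogonal_matrix (vector [a, c \<times> a, c] :: real ^ 3 ^ 3)"
    unfolding orthogonal_matrix_orthonormal_rows row_def orthogonal_def norm_eq_1
    by (simp add: rows)
  moreover have "det (vector [a, c \<times> a, c] :: real ^ 3 ^ 3) = 1"
    \<comment> \<open>The determinant is the triple product of the rows; permuted cyclically, it
      becomes the squared length of \<open>c \<times> a\<close>. The row order thus fixes the sign
      +1.\<close>
    using bb cross_triple[of "c \<times> a" c a] by (simp add: inner_commute flip: dot_cross_det)
  ultimately show ?thesis
    by (simp add: rotation_matrix_def)
qed

text \<open>The rows of \<open>R\<close> are \<open>a\<close>, \<open>c \<times> a\<close>,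
  \<open>c\<close>, where the unit vector \<open>a\<close> is orthogonal to both \<open>v\<close>
  and \<open>c\<close>. Such an \<open>a\<close> exists because two vectors span at most a plane,
  even when they are parallel.\<close>

lemma rotation_matrix_adapted:
  fixes v c :: "real ^ 3"
  assumes "norm c = 1"
  obtains R :: "real ^ 3 ^ 3" where
    "rotation_matrix R" and "R *v c = vector [0, 0, 1]" and "(R *v v) $ 1 = 0"
proof -
  have "dim {v, c} \<le> card {v, c}"
    by (rule dim_le_card') simp
  also have "\<dots> \<le> 2"
    by (simp add: card_insert_if)
  finally have "dim {v, c} < DIM(real ^ 3)"
    by simp
  then obtain a' where a': "a' \<noteq> 0" "\<And>y. y \<in> span {v, c} \<Longrightarrow> orthogonal a' y"
    using orthogonal_to_subspace_exists by blast
  define a where "a = sgn a'"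
  have a: "norm a = 1" "a \<bullet> v = 0" "a \<bullet> c = 0"
    using a'(1) a'(2)[of v] a'(2)[of c]
    by (simp_all add: a_def norm_sgn sgn_div_norm orthogonal_def span_base)
  let ?R = "vector [a, c \<times> a, c] :: real ^ 3 ^ 3"
  have nth: "(?R *v y) $ 1 = a \<bullet> y" "(?R *v y) $ 2 = (c \<times> a) \<bullet> y" "(?R *v y) $ 3 = c \<bullet> y" for y
    by (simp_all add: matrix_vector_mul_component)
  show thesis
  proof
    show "rotation_matrix ?R"
      by (rule rotation_matrix_from_orthonormal_pair) (use a assms in auto)
    show "?R *v c = vector [0, 0, 1]"
      using a assms by (simp add: vec_eq_iff forall_3 nth dot_cross_self norm_eq_1 inner_commute)
    show "(?R *v v) $ 1 = 0"
      by (simp add: nth a)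
  qed
qed

text \<open>The last conclusion is a disjunction because \<open>K\<close> must be positive:
  \<open>w = 0\<close> cannot be sent to \<open>vector [0, 0, - K]\<close>. In that case the proof
  takes \<open>K = 1\<close> and aligns \<open>v\<close> with the third axis, so that
  \<open>D = 0\<close>.\<close>

lemma rotation_to_standard_initial_data:
  fixes w v :: "real ^ 3"
  assumes "norm v = 1"
  obtains R :: "real ^ 3 ^ 3" and K D C3 :: real where
    "rotation_matrix R" and "K > 0" and "D\<^sup>2 + C3\<^sup>2 = 1" and "R *v v = vector [0, D, C3]"
    and "R *v w = vector [0, 0, - K] \<or> w = 0 \<and> D = 0"
proof -
  \<comment> \<open>The vector to be sent to the third axis. The minus sign makes \<open>w\<close>
    point downwards, which gives \<open>sin\<close> and \<open>cos\<close> in \<open>model_h\<close>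
    their signs.\<close>
  define c where "c = (if w = 0 then v else - sgn w)"
  have "norm c = 1"
    using assms by (simp add: c_def norm_sgn)
  then obtain R where R: "rotation_matrix R" "R *v c = vector [0, 0, 1]" "(R *v v) $ 1 = 0"
    by (rule rotation_matrix_adapted)
  have Rv: "R *v v = vector [0, (R *v v) $ 2, (R *v v) $ 3]"
    using R(3) by (simp add: vec_eq_iff forall_3)
  have "norm (R *v v) = norm v"
    using R(1) orthogonal_transformation_matrix[of "(*v) R"]
    by (simp add: rotation_matrix_def orthogonal_transformation)
  then have "(R *v v) \<bullet> (R *v v) = 1"
    using assms by (simp add: norm_eq_1)
  then have sq: "((R *v v) $ 2)\<^sup>2 + ((R *v v) $ 3)\<^sup>2 = 1"
    by (simp add: inner_vec_def sum_3 R(3) power2_eq_square)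
  show thesis
  proof (cases "w = 0")
    case True
    then have "R *v v = vector [0, 0, 1]"
      using R(2) by (simp add: c_def)
    then show ?thesis
      using that[of R 1 0 1] R(1) True by simp
  next
    case False
    then have "w = (- norm w) *\<^sub>R c"
      by (simp add: c_def sgn_div_norm)
    then have "R *v w = (- norm w) *\<^sub>R (R *v c)"
      by (metis matrix_vector_mult_scaleR)
    also have "\<dots> = vector [0, 0, - norm w]"
      by (simp add: R(2) vec_eq_iff forall_3)
    finally show ?thesis
      using that[of R "norm w"] R(1) False Rv sq by simp
  qed
qed

section \<open>The explicit curve and its differential equations\<close>

definition model_h :: "real \<Rightarrow> real \<Rightarrow> real \<Rightarrow> real \<Rightarrow> real ^ 3" where
  "model_h K D C3 t = vector [D * sin (K * t), D * cos (K * t), C3]"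

definition model_x :: "real \<Rightarrow> real \<Rightarrow> real \<Rightarrow> real \<Rightarrow> real ^ 3" where
  "model_x K D C3 t = vector [D / K * (1 - cos (K * t)), D / K * sin (K * t), C3 * t]"

text \<open>The components are the coefficients of the claimed curve in the order of
  \<open>gbivec\<close>: first that of \<open>e\<^sub>G 2 \<and>\<^sub>G e\<^sub>G 3\<close>, last
  that of \<open>e\<^sub>G 1 \<and>\<^sub>G e\<^sub>G 2\<close>.\<close>

definition model_z :: "real \<Rightarrow> real \<Rightarrow> real \<Rightarrow> real \<Rightarrow> real ^ 3" where
  "model_z K D C3 t = vector
    [C3 * D / (2 * K\<^sup>2) * (2 - K * t * sin (K * t) - 2 * cos (K * t)),
     - (C3 * D / (2 * K\<^sup>2) * (K * t - 2 * sin (K * t) + K * t * cos (K * t))),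
     - (D\<^sup>2 / (2 * K\<^sup>2) * (K * t - sin (K * t)))]"

lemma model_h_derivative:
  "(model_h K D C3 has_vector_derivative vector [0, 0, - K] \<times> model_h K D C3 t) (at t within T)"
proof -
  have "vector [0, 0, - K] \<times> model_h K D C3 t
      = vector [K * (D * cos (K * t)), - (K * (D * sin (K * t))), 0]"
    by (simp add: model_h_def cross3_def vec_eq_iff forall_3)
  then show ?thesis
    unfolding model_h_def[abs_def]
    by (auto intro!: has_vector_derivative_vector_3 derivative_eq_intros)
qed

lemma model_x_derivative:
  assumes "K \<noteq> 0"
  shows "(model_x K D C3 has_vector_derivative model_h K D C3 t) (at t within T)"
  unfolding model_x_def[abs_def] model_h_def using assms
  by (auto intro!: has_vector_derivative_vector_3 derivative_eq_intros)

lemma model_z_derivative: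
  assumes "K \<noteq> 0"
  shows "(model_z K D C3 has_vector_derivative (1 / 2) *\<^sub>R (model_x K D C3 t \<times> model_h K D C3 t))
    (at t within T)"
proof -
  \<comment> \<open>Only the third component of the vector product contains squares of
    \<open>sin\<close> and \<open>cos\<close>; this rule eliminates them there.\<close>
  have sq: "sin (K * t) * sin (K * t) = 1 - cos (K * t) * cos (K * t)"
    using sin_cos_squared_add[of "K * t"] by (simp add: power2_eq_square)
  have "(1 / 2) *\<^sub>R (model_x K D C3 t \<times> model_h K D C3 t)
      = vector [C3 * D / (2 * K) * (sin (K * t) - K * t * cos (K * t)),
          - (C3 * D / (2 * K) * (1 - cos (K * t) - K * t * sin (K * t))),
          - (D\<^sup>2 / (2 * K) * (1 - cos (K * t)))]"
    using assms
    by (simp add: model_x_def model_h_def cross3_def vec_eq_iff forall_3 field_simps power2_eq_square sq)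
  moreover have "(model_z K D C3 has_vector_derivative \<dots>) (at t within T)"
    unfolding model_z_def[abs_def]
  proof (rule has_vector_derivative_vector_3)
    show "((\<lambda>s. C3 * D / (2 * K\<^sup>2) * (2 - K * s * sin (K * s) - 2 * cos (K * s))) has_real_derivative
        C3 * D / (2 * K) * (sin (K * t) - K * t * cos (K * t))) (at t within T)"
      by (rule derivative_eq_intros refl)+ (use assms in \<open>simp add: power2_eq_square field_simps\<close>)
    show "((\<lambda>s. - (C3 * D / (2 * K\<^sup>2) * (K * s - 2 * sin (K * s) + K * s * cos (K * s))))
        has_real_derivative - (C3 * D / (2 * K) * (1 - cos (K * t) - K * t * sin (K * t)))) (at t within T)"
      by (rule derivative_eq_intros refl)+ (use assms in \<open>simp add: power2_eq_square field_simps\<close>)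
    show "((\<lambda>s. - (D\<^sup>2 / (2 * K\<^sup>2) * (K * s - sin (K * s)))) has_real_derivative
        - (D\<^sup>2 / (2 * K) * (1 - cos (K * t)))) (at t within T)"
      by (rule derivative_eq_intros refl)+ (use assms in \<open>simp add: power2_eq_square field_simps\<close>)
  qed
  ultimately show ?thesis
    by simp
qed

section \<open>Reduction of an arbitrary geodesic to the explicit curve\<close>

theorem proposition2:
  fixes T :: "real set" and q :: "real \<Rightarrow> (real ^ 3) \<times> (real ^ 3)"
  assumes "is_interval T" and "0 \<in> T"
    and "arclength_geodesic T q"
    and "fst (q 0) = 0" and "snd (q 0) = 0"
  shows "\<exists>(R :: real ^ 3 ^ 3) (K :: real) (D :: real) (C3 :: real).
    rotation_matrix R \<and> K > 0 \<and> D\<^sup>2 + C3\<^sup>2 = 1 \<and>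
    (\<forall>t\<in>T. to_mv (SO3_action R (q t)) =
        (D / K * (1 - cos (K * t))) *\<^sub>R e\<^sub>G 1 + (D / K * sin (K * t)) *\<^sub>R e\<^sub>G 2 + (C3 * t) *\<^sub>R e\<^sub>G 3
      - (D\<^sup>2 / (2 * K\<^sup>2) * (K * t - sin (K * t))) *\<^sub>R (e\<^sub>G 1 \<and>\<^sub>G e\<^sub>G 2)
      - (C3 * D / (2 * K\<^sup>2) * (K * t - 2 * sin (K * t) + K * t * cos (K * t))) *\<^sub>R (e\<^sub>G 3 \<and>\<^sub>G e\<^sub>G 1)
      + (C3 * D / (2 * K\<^sup>2) * (2 - K * t * sin (K * t) - 2 * cos (K * t))) *\<^sub>R (e\<^sub>G 2 \<and>\<^sub>G e\<^sub>G 3))"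
proof -
  have T: "convex T"
    using assms(1) by (simp add: is_interval_convex)
  obtain K1 K2 K3 h where ext: "normal_extremal T K1 K2 K3 h q" and unit: "\<forall>t\<in>T. norm (h t) = 1"
    using assms(3) by (auto simp: arclength_geodesic_def)
  define w :: "real ^ 3" where "w = vector [K3, - K2, K1]"
  have h: "(h has_vector_derivative w \<times> h t) (at t within T)"
    and x: "((\<lambda>s. fst (q s)) has_vector_derivative h t) (at t within T)"
    and z: "((\<lambda>s. snd (q s)) has_vector_derivative (1 / 2) *\<^sub>R (fst (q t) \<times> h t)) (at t within T)"
    if "t \<in> T" for t
    using ext that by (simp_all add: normal_extremal_def Omega_mult_eq_cross w_def)
  have "norm (h 0) = 1"
    using unit \<open>0 \<in> T\<close> by simp
  then obtain R K D C3 where R: "rotation_matrix R" and K: "K > 0" and DC: "D\<^sup>2 + C3\<^sup>2 = 1"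
    and Rh0: "R *v h 0 = vector [0, D, C3]"
    and Rw: "R *v w = vector [0, 0, - K] \<or> w = 0 \<and> D = 0"
    by (rule rotation_to_standard_initial_data)
  have cross: "R *v (u \<times> v) = (R *v u) \<times> (R *v v)" for u v
    using cross_rotation_matrix[OF R] by simp
  \<comment> \<open>This merges the two cases of \<open>Rw\<close>: if \<open>w = 0\<close> and
    \<open>D = 0\<close>, the model covector lies on the third axis and both products
    vanish.\<close>
  have model_h: "(R *v w) \<times> model_h K D C3 t = vector [0, 0, - K] \<times> model_h K D C3 t" for t
  proof (cases "w = 0 \<and> D = 0")
    case True
    then have "R *v w = 0"
      by simp
    with True show ?thesis
      by (simp add: model_h_def cross3_def)
  qed (use Rw in auto)
  have Rh: "R *v h t = model_h K D C3 t" if "t \<in> T" for t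
  \<comment> \<open>The operator uses \<open>R *v w\<close> because the rotated covector satisfies
    that equation in both cases; the model covector does so by \<open>model_h\<close>.\<close>
  proof (rule linear_skew_ode_unique[OF T \<open>0 \<in> T\<close> _ that, where B = "\<lambda>y. (R *v w) \<times> y"])
    show "R *v h 0 = model_h K D C3 0"
      by (simp add: Rh0 model_h_def)
    show "linear ((\<times>) (R *v w))"
      using bilinear_cross by (simp add: bilinear_def)
    show "((\<lambda>s. R *v h s) has_vector_derivative (R *v w) \<times> (R *v h s)) (at s within T)"
      if "s \<in> T" for s
      using has_vector_derivative_matrix_vector_mult[OF h[OF that], of R] by (simp add: cross)
    show "(model_h K D C3 has_vector_derivative (R *v w) \<times> model_h K D C3 s) (at s within T)" for s
      unfolding model_h by (rule model_h_derivative)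
  qed (simp add: dot_cross_self)
  have Rx: "R *v fst (q t) = model_x K D C3 t" if "t \<in> T" for t
  proof (rule has_vector_derivative_unique_on_convex[OF T \<open>0 \<in> T\<close> _ that])
    show "R *v fst (q 0) = model_x K D C3 0"
      by (simp add: assms(4) model_x_def vec_eq_iff forall_3)
    show "((\<lambda>s. R *v fst (q s)) has_vector_derivative model_h K D C3 s) (at s within T)"
      if "s \<in> T" for s
      using has_vector_derivative_matrix_vector_mult[OF x[OF that], of R] by (simp add: Rh that)
  qed (use K in \<open>simp add: model_x_derivative\<close>)
  have Rz: "R *v snd (q t) = model_z K D C3 t" if "t \<in> T" for t
  proof (rule has_vector_derivative_unique_on_convex[OF T \<open>0 \<in> T\<close> _ that])
    show "R *v snd (q 0) = model_z K D C3 0"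
      by (simp add: assms(5) model_z_def vec_eq_iff forall_3)
    show "((\<lambda>s. R *v snd (q s)) has_vector_derivative
        (1 / 2) *\<^sub>R (model_x K D C3 s \<times> model_h K D C3 s)) (at s within T)" if "s \<in> T" for s
      \<comment> \<open>The rotation passes through the vector product, whose factors are already
        identified by \<open>Rx\<close> and \<open>Rh\<close>.\<close>
      using has_vector_derivative_matrix_vector_mult[OF z[OF that], of R]
      by (simp add: Rh Rx that cross matrix_vector_mult_scaleR)
  qed (use K in \<open>simp add: model_z_derivative\<close>)
  show ?thesis
    by (intro exI[of _ R] exI[of _ K] exI[of _ D] exI[of _ C3] conjI R K DC ballI)
      (simp add: SO3_action_def to_mv_def gvec_def gbivec_def Rx Rz model_x_def model_z_def)
qed

end
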